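(* Let $(M_i)_{i\ge 1}$ be an increasing sequence of positive integers with $M_i\to\infty$, let $q_1=2$, $q_{i+1}=q_i^{M_i}$, and let $\phi:[2,\infty)\to(0,\infty)$ be monotone increasing with $\phi(t)\to\infty$. For each $i\ge1$ define $$G_i=\frac{1}{q_i}\big([0,q_i]\cap\mathbb Z\big),\qquad r_i=q_i^{-\phi(q_i)},\qquad E_i=\{x\in[0,1]:\operatorname{dist}(x,G_i)\le r_i\},\qquad E=\bigcap_{i=1}^\infty E_i.$$ Suppose there exist $\varepsilon>0$ and $C>0$ such that for all sufficiently large $n$, $$\prod_{j=1}^{n-1}\left(1+q_j^{M_j-\phi(q_j)}\right)\le C\left(\phi(q_n)\log q_n\right)^{1-\varepsilon}.$$ Then $$\dim_H^{\log}(E)\le 1-\varepsilon.$$ In particular, $\dim_H^{\log}(E)<1$.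
   Context: $\dim_H^{\log}$ denotes logarithmic Hausdorff dimension, defined as follows. For a gauge function $\psi$ (an increasing right-continuous function $\psi:\mathbb R_{\ge0}\to\mathbb R_{\ge0}$ with $\psi(0)=0$ and $\psi(t)>0$ for $t>0$), the outer Hausdorff measure is $$\mathcal H^\psi(F)=\lim_{\delta\to0}\inf\Big\{\sum_i\psi(\operatorname{diam}(U_i)):\operatorname{diam}(U_i)<\delta,\ F\subset\bigcup_iU_i\Big\},$$ the infimum being over countable covers. For $s>0$ let $h_s$ be a gauge function with $h_s(r)=(\log(1/r))^{-s}$ for sufficiently small $r>0$. Then $\dim_H^{\log}(F)$ is the infimum of all $s>0$ such that $\mathcal H^{h_s}(F)=0$. *)

theory Defs
  imports "HOL-Analysis.Analysis"
begin

definition gauge_function :: "(real \<Rightarrow> real) \<Rightarrow> bool" where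
  "gauge_function \<psi> \<longleftrightarrow>
     mono_on {0..} \<psi> \<and> (\<forall>t\<ge>0. continuous (at_right t) \<psi>) \<and>
     \<psi> 0 = 0 \<and> (\<forall>t>0. \<psi> t > 0)"

text \<open>Boundedness of the covering sets is required explicitly, since \<open>diameter\<close> is \<open>0\<close> on
  unbounded sets.  Finite covers are included because \<open>U i\<close> may be empty and
  \<open>\<psi> (diameter {}) = \<psi> 0 = 0\<close> for a gauge function.\<close>

definition hausdorff_content ::
  "(real \<Rightarrow> real) \<Rightarrow> real \<Rightarrow> 'a::metric_space set \<Rightarrow> ennreal" where
  "hausdorff_content \<psi> \<delta> F =
     (INF U \<in> {U :: nat \<Rightarrow> 'a set. (\<forall>i. bounded (U i) \<and> diameter (U i) < \<delta>) \<and> F \<subseteq> (\<Union>i. U i)}.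
        \<Sum>i. ennreal (\<psi> (diameter (U i))))"

definition hausdorff_measure :: "(real \<Rightarrow> real) \<Rightarrow> 'a::metric_space set \<Rightarrow> ennreal" where
  "hausdorff_measure \<psi> F = Lim (at_right 0) (\<lambda>\<delta>. hausdorff_content \<psi> \<delta> F)"

text \<open>The limit exists, by monotonicity in \<open>\<delta>\<close>.\<close>

lemma hausdorff_content_antimono:
  assumes "\<delta> \<le> \<delta>'"
  shows "hausdorff_content \<psi> \<delta>' F \<le> hausdorff_content \<psi> \<delta> F"
  unfolding hausdorff_content_def
  by (rule INF_superset_mono) (use assms in \<open>auto intro: less_le_trans\<close>)

lemma hausdorff_content_tendsto:
  "((\<lambda>\<delta>. hausdorff_content \<psi> \<delta> F) \<longlongrightarrow> (SUP \<delta>\<in>{0<..}. hausdorff_content \<psi> \<delta> F)) (at_right 0)"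
proof (rule order_tendstoI)
  fix a assume "a < (SUP \<delta>\<in>{0<..}. hausdorff_content \<psi> \<delta> F)"
  then obtain d where d: "d > 0" "a < hausdorff_content \<psi> d F"
    by (auto simp: less_SUP_iff)
  have "\<forall>\<^sub>F \<delta> in at_right 0. \<delta> < d"
    using d(1) by (auto simp: eventually_at_right_field)
  then show "\<forall>\<^sub>F \<delta> in at_right 0. a < hausdorff_content \<psi> \<delta> F"
  proof eventually_elim
    case (elim \<delta>)
    then show ?case
      using d(2) hausdorff_content_antimono[of \<delta> d \<psi> F] by (auto intro: less_le_trans)
  qed
next
  fix a assume *: "(SUP \<delta>\<in>{0<..}. hausdorff_content \<psi> \<delta> F) < a"
  have "\<forall>\<^sub>F \<delta> in at_right 0. (0::real) < \<delta>"
    by (rule eventually_at_right_less)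
  then show "\<forall>\<^sub>F \<delta> in at_right 0. hausdorff_content \<psi> \<delta> F < a"
  proof eventually_elim
    case (elim \<delta>)
    then have "hausdorff_content \<psi> \<delta> F \<le> (SUP \<delta>\<in>{0<..}. hausdorff_content \<psi> \<delta> F)"
      by (intro SUP_upper) auto
    then show ?case using * by (rule le_less_trans)
  qed
qed

lemma hausdorff_measure_eq_SUP:
  "hausdorff_measure \<psi> F = (SUP \<delta>\<in>{0<..}. hausdorff_content \<psi> \<delta> F)"
  unfolding hausdorff_measure_def
  by (rule tendsto_Lim[OF _ hausdorff_content_tendsto]) simp

text \<open>One choice of \<open>h\<^sub>s\<close>.  The lemmas below show that it is a gauge function and that any other
  choice gives the same Hausdorff measure.\<close>

definition log_gauge :: "real \<Rightarrow> real \<Rightarrow> real" where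
  "log_gauge s r =
     (if r \<le> 0 then 0 else if r < exp (- 1) then ln (1 / r) powr (- s) else 1)"

lemma gauge_function_log_gauge:
  assumes "s > 0"
  shows "gauge_function (log_gauge s)"
  unfolding gauge_function_def
proof (intro conjI allI impI)
  have ln_ge: "1 < ln (1 / r)" if "0 < r" "r < exp (- 1)" for r :: real
  proof -
    have "ln r < ln (exp (- 1))" using that by (subst ln_less_cancel_iff) auto
    then show ?thesis using that by (simp add: ln_div)
  qed
  have le1: "ln (1 / r) powr (- s) \<le> 1" if "0 < r" "r < exp (- 1)" for r :: real
  proof -
    have "ln (1 / r) powr (- s) \<le> ln (1 / r) powr 0"
      using ln_ge[OF that] assms by (intro powr_mono) auto
    then show ?thesis using ln_ge[OF that] by auto
  qed
  show "mono_on {0..} (log_gauge s)"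
  proof (rule mono_onI)
    fix x y :: real assume xy: "x \<in> {0..}" "x \<le> y"
    show "log_gauge s x \<le> log_gauge s y"
    proof (cases "0 < x \<and> y < exp (- 1)")
      case True
      moreover have "exp (- 1) < (1::real)" by simp
      ultimately have "y < 1" by linarith
      with True have "ln (1 / y) powr (- s) \<ge> ln (1 / x) powr (- s)"
        using xy ln_ge[of y] assms
        by (intro powr_mono2') (auto simp: ln_div)
      then show ?thesis using True xy by (auto simp: log_gauge_def)
    next
      case False
      then show ?thesis using xy le1[of x] by (auto simp: log_gauge_def)
    qed
  qed
  show "log_gauge s 0 = 0" by (simp add: log_gauge_def)
  show "log_gauge s t > 0" if "t > 0" for t
    using that ln_ge[of t] by (auto simp: log_gauge_def)
  show "continuous (at_right t) (log_gauge s)" if t: "t \<ge> 0" for t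
  proof -
    consider "t = 0" | "0 < t" "t < exp (- 1)" | "exp (- 1) \<le> t" using t by linarith
    then show ?thesis
    proof cases
      case 1
      have "\<forall>\<^sub>F r in at_right (0::real). r < exp (- 1)"
        by (auto simp: eventually_at_right_field intro: exI[of _ "exp (- 1)"])
      then have ev: "\<forall>\<^sub>F r in at_right (0::real). log_gauge s r = ln (1 / r) powr (- s)"
        using eventually_at_right_less[of 0]
        by eventually_elim (auto simp: log_gauge_def)
      have "filterlim (\<lambda>r::real. ln (1 / r)) at_top (at_right 0)"
        using filterlim_compose[OF ln_at_top filterlim_inverse_at_top_right]
        by (simp add: divide_inverse)
      then have "((\<lambda>r. ln (1 / r) powr (- s)) \<longlongrightarrow> 0) (at_right (0::real))"
        using assms by (intro tendsto_neg_powr) auto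
      then have "(log_gauge s \<longlongrightarrow> 0) (at_right 0)"
        using ev by (simp add: filterlim_cong)
      then show ?thesis using 1 by (simp add: continuous_within log_gauge_def)
    next
      case 2
      have "\<forall>\<^sub>F r in at_right t. r < exp (- 1)"
        using 2 by (auto simp: eventually_at_right_field)
      then have ev: "\<forall>\<^sub>F r in at_right t. log_gauge s r = ln (1 / r) powr (- s)"
        using eventually_at_right_less[of t]
        by eventually_elim (use 2 in \<open>auto simp: log_gauge_def\<close>)
      have "((\<lambda>r. ln (1 / r) powr (- s)) \<longlongrightarrow> ln (1 / t) powr (- s)) (at_right t)"
        using 2 ln_ge[of t] by (intro tendsto_intros) auto
      then have "(log_gauge s \<longlongrightarrow> ln (1 / t) powr (- s)) (at_right t)"
        using ev by (simp add: filterlim_cong)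
      then show ?thesis using 2 by (simp add: continuous_within log_gauge_def)
    next
      case 3
      have "t > 0" using 3 exp_gt_zero[of "-1::real"] by linarith
      have ev: "\<forall>\<^sub>F r in at_right t. log_gauge s r = 1"
        using eventually_at_right_less[of t]
        by eventually_elim (use 3 \<open>t > 0\<close> in \<open>auto simp: log_gauge_def\<close>)
      have "(log_gauge s \<longlongrightarrow> 1) (at_right t)"
        using ev by (simp add: filterlim_cong tendsto_eventually)
      then show ?thesis using 3 \<open>t > 0\<close> by (simp add: continuous_within log_gauge_def)
    qed
  qed
qed

lemma hausdorff_measure_log_gauge_unique:
  fixes F :: "'a::metric_space set"
  assumes "gauge_function h" and "\<forall>\<^sub>F r in at_right 0. h r = ln (1 / r) powr (- s)"
  shows "hausdorff_measure h F = hausdorff_measure (log_gauge s) F"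
proof -
  obtain b where b: "b > 0" "\<And>r. 0 < r \<Longrightarrow> r < b \<Longrightarrow> h r = ln (1 / r) powr (- s)"
    using assms(2) by (auto simp: eventually_at_right_field)
  have eq: "h r = log_gauge s r" if "0 \<le> r" "r < min b (exp (- 1))" for r
    using that b assms(1) by (cases "r = 0") (auto simp: log_gauge_def gauge_function_def)
  have cong: "hausdorff_content h \<delta> F = hausdorff_content (log_gauge s) \<delta> F"
    if "\<delta> < min b (exp (- 1))" for \<delta>
    unfolding hausdorff_content_def
  proof (intro INF_cong refl arg_cong[where f = suminf] ext)
    fix U :: "nat \<Rightarrow> 'a set" and i
    assume "U \<in> {U. (\<forall>i. bounded (U i) \<and> diameter (U i) < \<delta>) \<and> F \<subseteq> (\<Union>i. U i)}"
    then have "bounded (U i)" "diameter (U i) < \<delta>" by auto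
    then have "h (diameter (U i)) = log_gauge s (diameter (U i))"
      using that by (intro eq diameter_ge_0) auto
    then show "ennreal (h (diameter (U i))) = ennreal (log_gauge s (diameter (U i)))" by simp
  qed
  have "\<forall>\<^sub>F \<delta> in at_right 0. \<delta> < min b (exp (- 1))"
    using b(1) by (auto simp: eventually_at_right_field intro: exI[of _ "min b (exp (- 1))"])
  then have "\<forall>\<^sub>F \<delta> in at_right 0. hausdorff_content h \<delta> F = hausdorff_content (log_gauge s) \<delta> F"
    by eventually_elim (rule cong)
  then have "((\<lambda>\<delta>. hausdorff_content h \<delta> F) \<longlongrightarrow> hausdorff_measure (log_gauge s) F) (at_right 0)"
    using hausdorff_content_tendsto[of "log_gauge s" F]
    by (simp add: filterlim_cong hausdorff_measure_eq_SUP)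
  then show ?thesis
    unfolding hausdorff_measure_def[of h] by (intro tendsto_Lim) auto
qed

text \<open>Extended-real valued, so that the infimum of the empty set is \<open>\<infinity>\<close>.\<close>

definition log_hausdorff_dim :: "'a::metric_space set \<Rightarrow> ereal" where
  "log_hausdorff_dim F = Inf {ereal s | s. s > 0 \<and> hausdorff_measure (log_gauge s) F = 0}"

definition grid :: "nat \<Rightarrow> real set" where
  "grid q = (\<lambda>x. 1 / real q * x) ` ({0..real q} \<inter> \<int>)"

definition grid_radius :: "(real \<Rightarrow> real) \<Rightarrow> nat \<Rightarrow> real" where
  "grid_radius \<phi> q = real q powr (- \<phi> (real q))"

definition grid_nbhd :: "(real \<Rightarrow> real) \<Rightarrow> nat \<Rightarrow> real set" where
  "grid_nbhd \<phi> q = {x \<in> {0..1}. infdist x (grid q) \<le> grid_radius \<phi> q}"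

end

theory Submission
  imports Defs
begin

text \<open>
  The set \<open>E\<close> is covered by the balls of radius \<open>r\<^sub>n\<close> around a subset \<open>A\<^sub>n\<close> of \<open>(1 / q\<^sub>n) \<int>\<close>. A point of
  \<open>A\<^sub>n\<^sub>+\<^sub>1\<close> may be kept only if it is within \<open>r\<^sub>n + r\<^sub>n\<^sub>+\<^sub>1\<close> of \<open>A\<^sub>n\<close>, so as soon as \<open>\<phi> (q\<^sub>n\<^sub>+\<^sub>1) \<ge> 1\<close> the
  cardinality grows by at most the factor \<open>3 (1 + q\<^sub>n\<^sub>+\<^sub>1 r\<^sub>n)\<close>, where
  \<open>q\<^sub>n\<^sub>+\<^sub>1 r\<^sub>n = q\<^sub>n powr (M\<^sub>n - \<phi> (q\<^sub>n))\<close>. The accumulated \<open>3 ^ n\<close> is harmless: since \<open>M\<^sub>n \<rightarrow> \<infinity>\<close>, the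
  sequence \<open>ln q\<^sub>n\<close> grows faster than any exponential. Hence the cover has total gauge
  at most a constant times \<open>3 ^ n (\<phi> (q\<^sub>n) ln q\<^sub>n) powr (1 - \<epsilon> - s) \<rightarrow> 0\<close> for every \<open>s > 1 - \<epsilon>\<close>.
\<close>

section \<open>Hausdorff measure bounded by finite covers with balls of equal radius\<close>

lemma card_int_between_le:
  fixes a b :: real
  assumes "a \<le> b"
  shows "finite {k :: int. a \<le> k \<and> k \<le> b}" "real (card {k :: int. a \<le> k \<and> k \<le> b}) \<le> b - a + 1"
proof -
  have eq: "{k :: int. a \<le> k \<and> k \<le> b} = {\<lceil>a\<rceil>..\<lfloor>b\<rfloor>}"
    by (auto simp: ceiling_le_iff le_floor_iff)
  show "finite {k :: int. a \<le> k \<and> k \<le> b}" by (simp add: eq)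
  show "real (card {k :: int. a \<le> k \<and> k \<le> b}) \<le> b - a + 1"
    unfolding eq card_atLeastAtMost_int using assms by linarith
qed

lemma hausdorff_content_le_card:
  fixes F :: "'a::metric_space set"
  assumes \<psi>: "gauge_function \<psi>" and A: "finite A" and F: "F \<subseteq> (\<Union>g\<in>A. cball g r)"
    and r: "0 \<le> r" "2 * r < \<delta>"
  shows "hausdorff_content \<psi> \<delta> F \<le> ennreal (real (card A) * \<psi> (2 * r))"
proof -
  obtain e where e: "bij_betw e {..<card A} A"
    using ex_bij_betw_nat_finite[OF A] by (auto simp: atLeast0LessThan)
  \<comment> \<open>The finite cover is padded with empty sets, which cost nothing since
    \<open>\<psi> 0 = 0\<close>.\<close>
  define U where "U i = (if i < card A then cball (e i) r else {})" for i
  have diam: "diameter (U i) \<le> 2 * r" for i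
  proof -
    have "dist y z \<le> 2 * r" if "y \<in> U i" "z \<in> U i" for y z
      using that dist_triangle3[of y z "e i"] by (auto simp: U_def split: if_splits)
    then show ?thesis using r by (auto simp: diameter_def intro!: cSUP_least)
  qed
  have bdd: "bounded (U i)" for i by (simp add: U_def)
  have "F \<subseteq> (\<Union>i. U i)"
  proof
    fix x assume "x \<in> F"
    then obtain g where g: "g \<in> A" "x \<in> cball g r" using F by blast
    from g(1) have "g \<in> e ` {..<card A}" using e by (simp add: bij_betw_def)
    then obtain i where "i < card A" "e i = g" by blast
    then have "x \<in> U i" using g by (simp add: U_def)
    then show "x \<in> (\<Union>i. U i)" by blast
  qed
  then have "hausdorff_content \<psi> \<delta> F \<le> (\<Sum>i. ennreal (\<psi> (diameter (U i))))"
    unfolding hausdorff_content_def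
    using bdd diam r by (intro INF_lower) (auto intro: le_less_trans)
  also have "\<dots> = (\<Sum>i<card A. ennreal (\<psi> (diameter (U i))))"
    using \<psi> by (intro suminf_finite) (auto simp: U_def gauge_function_def)
  also have "\<dots> \<le> (\<Sum>i<card A. ennreal (\<psi> (2 * r)))"
    using \<psi> diam r diameter_ge_0[OF bdd]
    by (intro sum_mono ennreal_leI) (auto simp: gauge_function_def elim!: mono_onD)
  also have "\<dots> = ennreal (real (card A) * \<psi> (2 * r))"
    by (simp add: ennreal_mult' ennreal_of_nat_eq_real_of_nat)
  finally show ?thesis .
qed

text \<open>For a fixed \<open>\<delta>\<close>, eventually \<open>2 * r n < \<delta>\<close>, so
  every late cover is admissible at that scale. The content is thus below a null sequence for each
  \<open>\<delta>\<close>, and so is the supremum over \<open>\<delta>\<close>.\<close>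

lemma hausdorff_measure_eq_0I:
  assumes \<psi>: "gauge_function \<psi>" and A: "\<forall>\<^sub>F n in sequentially. finite (A n) \<and> F \<subseteq> (\<Union>g\<in>A n. cball g (r n))"
    and r: "\<And>n. 0 \<le> r n" "r \<longlonglongrightarrow> 0" and lim: "(\<lambda>n. real (card (A n)) * \<psi> (2 * r n)) \<longlonglongrightarrow> 0"
  shows "hausdorff_measure \<psi> F = 0"
proof -
  have "hausdorff_content \<psi> \<delta> F \<le> 0" if "\<delta> > 0" for \<delta>
  proof (rule tendsto_lowerbound)
    show "(\<lambda>n. ennreal (real (card (A n)) * \<psi> (2 * r n))) \<longlonglongrightarrow> 0"
      using tendsto_ennrealI[OF lim] by simp
    have "\<forall>\<^sub>F n in sequentially. r n < \<delta> / 2"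
      using order_tendstoD(2)[OF r(2), of "\<delta> / 2"] that by simp
    with A show "\<forall>\<^sub>F n in sequentially. hausdorff_content \<psi> \<delta> F \<le> ennreal (real (card (A n)) * \<psi> (2 * r n))"
      by eventually_elim (use \<psi> r in \<open>auto intro!: hausdorff_content_le_card\<close>)
  qed simp
  then show ?thesis by (simp add: hausdorff_measure_eq_SUP)
qed

section \<open>Grid neighbourhoods and refinement of covers\<close>

lemma grid_eq: "grid q = (\<lambda>k. of_int k / real q) ` {0..int q}"
proof -
  have "{0..real q} \<inter> \<int> = of_int ` {0..int q}"
    by (auto elim!: Ints_cases)
  then show ?thesis by (simp add: grid_def image_image)
qed

text \<open>The grid is finite and nonempty, so the infimum distance is attained at a grid
  point.\<close>

lemma grid_nbhd_obtain:
  assumes "x \<in> grid_nbhd \<phi> q"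
  obtains k :: int where "k \<in> {0..int q}" "\<bar>x - of_int k / real q\<bar> \<le> grid_radius \<phi> q"
proof -
  have "closed (grid q)" "grid q \<noteq> {}" by (auto simp: grid_eq intro!: finite_imp_closed)
  then obtain g where "g \<in> grid q" "infdist x (grid q) = dist x g"
    using infdist_attains_inf by metis
  then show ?thesis using that assms by (auto simp: grid_eq grid_nbhd_def dist_real_def)
qed

text \<open>If a point of \<open>F\<close> is within \<open>r\<close> of \<open>g\<close> and within
  \<open>R\<close> of \<open>k / q\<close>, where \<open>R\<close> is the grid radius, then
  \<open>k / q\<close> is within \<open>r + R\<close> of \<open>g\<close>. For each \<open>g\<close>
  this leaves at most \<open>2 * q * (r + R) + 1\<close> integers \<open>k\<close>, and
  \<open>q * R \<le> 1\<close> absorbs the \<open>R\<close> term into the constant 3.\<close>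

lemma cover_refine:
  fixes A F :: "real set"
  assumes A: "finite A" "F \<subseteq> (\<Union>g\<in>A. cball g r)" and F: "F \<subseteq> grid_nbhd \<phi> q" and "q > 0"
    and r: "0 \<le> r" and qr: "real q * grid_radius \<phi> q \<le> 1"
  shows "\<exists>B. finite B \<and> F \<subseteq> (\<Union>g\<in>B. cball g (grid_radius \<phi> q)) \<and>
    real (card B) \<le> real (card A) * (3 * (1 + real q * r))"
proof -
  define R where "R = grid_radius \<phi> q"
  have "R \<ge> 0" by (simp add: R_def grid_radius_def)
  define K where "K g = {k :: int. real q * (g - r - R) \<le> k \<and> k \<le> real q * (g + r + R)}" for g
  define B where "B = (\<Union>g\<in>A. (\<lambda>k. of_int k / real q :: real) ` K g)"
  have le: "real q * (g - r - R) \<le> real q * (g + r + R)" for g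
    using r \<open>R \<ge> 0\<close> by (intro mult_left_mono) auto
  have fin: "finite (K g)" for g unfolding K_def by (rule card_int_between_le[OF le])
  have card: "real (card (K g)) \<le> 3 * (1 + real q * r)" for g
  proof -
    have "real (card (K g)) \<le> real q * (g + r + R) - real q * (g - r - R) + 1"
      unfolding K_def by (rule card_int_between_le[OF le])
    also have "\<dots> = 1 + 2 * (real q * R) + 2 * (real q * r)" by (simp add: algebra_simps)
    also have "\<dots> \<le> 3 * (1 + real q * r)"
      using qr mult_nonneg_nonneg[OF of_nat_0_le_iff r, of q] unfolding R_def distrib_left by linarith
    finally show ?thesis .
  qed
  have "finite B" using A fin by (simp add: B_def)
  moreover have "F \<subseteq> (\<Union>g\<in>B. cball g R)"
  proof
    fix x assume x: "x \<in> F"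
    then obtain g where g: "g \<in> A" "\<bar>x - g\<bar> \<le> r"
      using A by (auto simp: dist_real_def abs_minus_commute)
    obtain k :: int where k: "\<bar>x - of_int k / real q\<bar> \<le> R"
      using grid_nbhd_obtain F x R_def by blast
    have "g - r - R \<le> of_int k / real q" "of_int k / real q \<le> g + r + R"
      using g k by linarith+
    then have "k \<in> K g" using \<open>q > 0\<close> by (simp add: K_def field_simps)
    then show "x \<in> (\<Union>g\<in>B. cball g R)"
      using g k by (auto simp: B_def dist_real_def abs_minus_commute)
  qed
  moreover have "real (card B) \<le> real (card A) * (3 * (1 + real q * r))"
  proof -
    have "card B \<le> (\<Sum>g\<in>A. card (K g))"
      unfolding B_def using A(1) fin
      by (intro order_trans[OF card_UN_le] sum_mono card_image_le) auto
    then have "real (card B) \<le> (\<Sum>g\<in>A. real (card (K g)))" by (simp flip: of_nat_sum)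
    also have "\<dots> \<le> real (card A) * (3 * (1 + real q * r))"
      using card by (intro sum_bounded_above) auto
    finally show ?thesis .
  qed
  ultimately show ?thesis unfolding R_def by blast
qed

section \<open>Analytic estimates\<close>

text \<open>For large \<open>n\<close>, consecutive terms have ratio
  \<open>b * m n powr (- d)\<close>, which tends to 0. The ratio test gives summability, hence a
  null sequence.\<close>

lemma exp_times_powr_tendsto_0:
  fixes L m :: "nat \<Rightarrow> real"
  assumes "\<forall>\<^sub>F n in sequentially. 0 < L n \<and> L (Suc n) = m n * L n"
    and m: "filterlim m at_top sequentially" and "b > 0" "d > 0"
  shows "(\<lambda>n. b ^ n * L n powr (- d)) \<longlonglongrightarrow> 0"
proof -
  have "(\<lambda>n. m n powr (- d)) \<longlonglongrightarrow> 0"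
    using m \<open>d > 0\<close> by (intro tendsto_neg_powr) auto
  then have "\<forall>\<^sub>F n in sequentially. m n powr (- d) < 1 / (2 * b)"
    by (rule order_tendstoD) (use \<open>b > 0\<close> in simp)
  moreover have "\<forall>\<^sub>F n in sequentially. m n > 0"
    using m by (simp add: filterlim_at_top_dense)
  ultimately have "\<forall>\<^sub>F n in sequentially.
      norm (b ^ Suc n * L (Suc n) powr (- d)) \<le> 1 / 2 * norm (b ^ n * L n powr (- d))"
    using assms(1)
  proof eventually_elim
    case (elim n)
    have "b * m n powr (- d) \<le> 1 / 2" using elim \<open>b > 0\<close> by (simp add: field_simps)
    then have "(b * m n powr (- d)) * (b ^ n * L n powr (- d)) \<le> 1 / 2 * (b ^ n * L n powr (- d))"
      using \<open>b > 0\<close> by (intro mult_right_mono) auto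
    then show ?case using elim \<open>b > 0\<close> by (simp add: powr_mult mult_ac)
  qed
  then obtain N where "\<And>n. n \<ge> N \<Longrightarrow>
      norm (b ^ Suc n * L (Suc n) powr (- d)) \<le> 1 / 2 * norm (b ^ n * L n powr (- d))"
    by (auto simp: eventually_sequentially)
  then have "summable (\<lambda>n. b ^ n * L n powr (- d))"
    by (intro summable_ratio_test[of "1 / 2" N]) auto
  then show ?thesis by (rule summable_LIMSEQ_zero)
qed

text \<open>Since \<open>ln 2 < 1\<close>, the bound \<open>x \<ge> 2\<close> puts the argument on
  the logarithmic branch of the gauge and gives \<open>x - ln 2 \<ge> x / 2\<close>. The factor
  \<open>2 powr s\<close> pays for replacing \<open>x - ln 2\<close> by
  \<open>x / 2\<close>.\<close>

lemma log_gauge_le: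
  assumes "s > 0" "x \<ge> 2"
  shows "log_gauge s (2 * exp (- x)) \<le> 2 powr s * x powr (- s)"
proof -
  have ln2: "ln 2 < (1::real)" using ln_2_less_1 by simp
  have "ln (2 * exp (- x)) < ln (exp (- 1))" using assms ln2 by (simp add: ln_mult)
  then have lt: "2 * exp (- x) < exp (- 1)" by (subst (asm) ln_less_cancel_iff) auto
  have "ln (1 / (2 * exp (- x))) = x - ln 2" by (simp add: ln_div ln_mult)
  then have "log_gauge s (2 * exp (- x)) = (x - ln 2) powr (- s)"
    using lt by (simp add: log_gauge_def)
  also have "\<dots> \<le> (x / 2) powr (- s)"
    using assms ln2 by (intro powr_mono2') auto
  also have "\<dots> = 2 powr s * x powr (- s)"
    using assms by (simp add: powr_divide powr_minus field_simps)
  finally show ?thesis .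
qed

theorem proposition2p11:
  fixes M q :: "nat \<Rightarrow> nat" and \<phi> :: "real \<Rightarrow> real" and E :: "real set" and \<epsilon> C :: real
  assumes M_pos: "\<forall>i\<ge>1. M i > 0"
    and M_mono: "mono_on {1..} M"
    and M_lim: "filterlim M at_top sequentially"
    and q_1: "q 1 = 2"
    and q_Suc: "\<forall>i\<ge>1. q (i + 1) = q i ^ M i"
    and \<phi>_pos: "\<forall>t\<ge>2. \<phi> t > 0"
    and \<phi>_mono: "mono_on {2..} \<phi>"
    and \<phi>_lim: "filterlim \<phi> at_top at_top"
    and E_def: "E = (\<Inter>i\<in>{1..}. grid_nbhd \<phi> (q i))"
    and \<epsilon>_pos: "\<epsilon> > 0"
    and C_pos: "C > 0"
    and growth: "\<forall>\<^sub>F n in sequentially.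
      (\<Prod>j\<in>{1..n - 1}. 1 + real (q j) powr (real (M j) - \<phi> (real (q j))))
        \<le> C * (\<phi> (real (q n)) * ln (real (q n))) powr (1 - \<epsilon>)"
  shows "log_hausdorff_dim E \<le> ereal (1 - \<epsilon>) \<and> log_hausdorff_dim E < 1"
proof -
  define r where "r n = grid_radius \<phi> (q n)" for n
  define L where "L n = ln (real (q n))" for n
  \<comment> \<open>For \<open>n \<ge> 1\<close>, \<open>x n\<close> is \<open>ln (1 / r n)\<close>,
    the quantity that the gauge sees; it is also the base of the power in the growth
    hypothesis.\<close>
  define x where "x n = \<phi> (real (q n)) * L n" for n
  define P where "P n = (\<Prod>j\<in>{1..n - 1}. 1 + real (q j) powr (real (M j) - \<phi> (real (q j))))" for n

  \<comment> \<open>Growth of \<open>q\<close> and the limits of \<open>L\<close>, \<open>x\<close>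
    and \<open>r\<close>\<close>
  have q_ge: "q n \<ge> 2" if "n \<ge> 1" for n
    using that
  proof (induction n rule: dec_induct)
    case (step n)
    have "2 \<le> q n ^ 1" using step by simp
    also have "\<dots> \<le> q n ^ M n" using step M_pos by (intro power_increasing) (auto simp: Suc_le_eq)
    finally show ?case using step q_Suc by simp
  qed (use q_1 in simp)
  have L_pos: "L n > 0" if "n \<ge> 1" for n using q_ge[OF that] by (simp add: L_def)
  have L_Suc: "L (Suc n) = real (M n) * L n" if "n \<ge> 1" for n
    using q_ge[OF that] q_Suc that by (simp add: L_def ln_realpow)
  \<comment> \<open>The recursion says nothing about \<open>q 0\<close>, hence the eventual
    form.\<close>
  have L_ev: "\<forall>\<^sub>F n in sequentially. 0 < L n \<and> L (Suc n) = real (M n) * L n"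
    using eventually_ge_at_top[of 1] by eventually_elim (auto simp: L_pos L_Suc)
  have M_real: "filterlim (\<lambda>n. real (M n)) at_top sequentially"
    by (rule filterlim_compose[OF filterlim_real_sequentially M_lim])
  note L_lim = exp_times_powr_tendsto_0[OF L_ev M_real]
  have L_top: "filterlim L at_top sequentially"
  proof -
    have ev: "\<forall>\<^sub>F n in sequentially. 0 < inverse (L n)" using L_ev by eventually_elim auto
    \<comment> \<open>The case \<open>b = d = 1\<close> of \<open>L_lim\<close> says that
      \<open>inverse (L n)\<close> tends to 0.\<close>
    have "\<forall>\<^sub>F n in sequentially. 1 ^ n * L n powr (- 1) = inverse (L n)"
      using L_ev by eventually_elim (auto simp: powr_minus)
    then have "(\<lambda>n. inverse (L n)) \<longlonglongrightarrow> 0"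
      using L_lim[of 1 1] by (auto intro: Lim_transform_eventually)
    from filterlim_inverse_at_top[OF this ev] show ?thesis by simp
  qed
  have "filterlim (\<lambda>n. exp (L n)) at_top sequentially"
    by (rule filterlim_compose[OF exp_at_top L_top])
  moreover have "\<forall>\<^sub>F n in sequentially. exp (L n) = real (q n)"
    using eventually_ge_at_top[of 1] by eventually_elim (use q_ge in \<open>force simp: L_def\<close>)
  ultimately have q_top: "filterlim (\<lambda>n. real (q n)) at_top sequentially"
    by (simp add: filterlim_cong)
  have "filterlim (\<lambda>n. \<phi> (real (q n))) at_top sequentially"
    by (rule filterlim_compose[OF \<phi>_lim q_top])
  then have \<phi>_ge: "\<forall>\<^sub>F n in sequentially. \<phi> (real (q n)) \<ge> 1"
    by (simp add: filterlim_at_top)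
  have x_ge: "\<forall>\<^sub>F n in sequentially. L n \<le> x n"
    using \<phi>_ge L_ev by eventually_elim (auto simp: x_def)
  have x_top: "filterlim x at_top sequentially"
    by (rule filterlim_at_top_mono[OF L_top x_ge])
  have r_eq: "\<forall>\<^sub>F n in sequentially. r n = exp (- x n)"
    using eventually_ge_at_top[of 1]
    by eventually_elim (use q_ge in \<open>force simp: r_def grid_radius_def x_def L_def powr_def\<close>)
  have "(\<lambda>n. exp (- x n)) \<longlonglongrightarrow> 0"
    by (intro filterlim_compose[OF exp_at_bot] filterlim_compose[OF filterlim_uminus_at_bot_at_top x_top])
  then have r_lim: "r \<longlonglongrightarrow> 0"
    using r_eq by (simp add: filterlim_cong)

  have growth': "\<forall>\<^sub>F n in sequentially. P n \<le> C * x n powr (1 - \<epsilon>)"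
    using growth by (simp add: P_def x_def L_def)
  have P_ge: "P n \<ge> 1" for n
    unfolding P_def by (intro prod_ge_1) auto
  have P_Suc: "P (Suc n) = P n * (1 + real (q (Suc n)) * r n)" if "n \<ge> 1" for n
  proof -
    \<comment> \<open>With \<open>n = Suc m\<close> the truncated \<open>n - 1\<close> in the index
      set becomes \<open>m\<close>, so the factor for \<open>j = n\<close> splits off.\<close>
    obtain m where [simp]: "n = Suc m" using \<open>n \<ge> 1\<close> by (cases n) auto
    have "real (q (Suc n)) = real (q n) powr real (M n)"
      using q_ge[OF that] q_Suc that by (simp add: powr_realpow)
    then have "real (q (Suc n)) * r n = real (q n) powr (real (M n) - \<phi> (real (q n)))"
      by (simp add: r_def grid_radius_def powr_diff powr_minus field_simps)
    then show ?thesis by (simp add: P_def)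
  qed

  \<comment> \<open>Covers of \<open>E\<close> by balls of radius \<open>r n\<close>\<close>
  obtain N where N: "N \<ge> 1" "\<And>n. n \<ge> N \<Longrightarrow> \<phi> (real (q n)) \<ge> 1"
    using eventually_conj[OF \<phi>_ge eventually_ge_at_top[of 1]]
    unfolding eventually_sequentially by blast
  \<comment> \<open>The induction starts at \<open>N\<close>, where \<open>\<phi>\<close> has
    reached 1. \<open>K\<close> bounds the size of the full grid there; no saving from earlier
    levels is needed, as \<open>K\<close> does not depend on \<open>n\<close>.\<close>
  define K where "K = real (q N) + 1"
  have E_sub: "E \<subseteq> grid_nbhd \<phi> (q n)" if "n \<ge> 1" for n using that E_def by auto
  have r_ge: "r n \<ge> 0" for n by (simp add: r_def grid_radius_def)
  have cover: "\<exists>A. finite A \<and> E \<subseteq> (\<Union>g\<in>A. cball g (r n)) \<and> real (card A) \<le> K * 3 ^ n * P n"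
    if "n \<ge> N" for n
    using that
  proof (induction n rule: dec_induct)
    case base
    define A where "A = grid (q N)"
    have "finite A" by (simp add: A_def grid_eq)
    moreover have "E \<subseteq> (\<Union>g\<in>A. cball g (r N))"
    proof
      fix y assume "y \<in> E"
      then obtain k :: int where "k \<in> {0..int (q N)}" "\<bar>y - of_int k / real (q N)\<bar> \<le> r N"
        using grid_nbhd_obtain[OF subsetD[OF E_sub[OF N(1)]]] unfolding r_def by blast
      then show "y \<in> (\<Union>g\<in>A. cball g (r N))"
        by (auto simp: A_def grid_eq dist_real_def abs_minus_commute)
    qed
    moreover have "real (card A) \<le> K * 3 ^ N * P N"
    proof -
      have "card A \<le> card {0..int (q N)}" unfolding A_def grid_eq by (intro card_image_le) simp
      then have "real (card A) \<le> K * 1" by (simp add: K_def)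
      also have "\<dots> \<le> K * (3 ^ N * P N)"
        using P_ge[of N] one_le_power[of "3::real" N] mult_mono[of 1 "3 ^ N" 1 "P N"]
        by (intro mult_left_mono) (auto simp: K_def)
      finally show ?thesis by (simp add: mult_ac)
    qed
    ultimately show ?case by blast
  next
    case (step n)
    then obtain A where A: "finite A" "E \<subseteq> (\<Union>g\<in>A. cball g (r n))" "real (card A) \<le> K * 3 ^ n * P n"
      by blast
    have n: "n \<ge> 1" using step N by simp
    define Q where "Q = real (q (Suc n))"
    have Q: "Q \<ge> 2" "\<phi> Q \<ge> 1" using q_ge[of "Suc n"] N(2)[of "Suc n"] step by (auto simp: Q_def)
    \<comment> \<open>Here \<open>\<phi> Q \<ge> 1\<close> enters: it yields the hypothesis
      \<open>q * R \<le> 1\<close> of \<open>cover_refine\<close>.\<close>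
    have "Q * Q powr (- \<phi> Q) = Q powr (1 - \<phi> Q)"
      using Q by (simp add: powr_diff powr_minus field_simps)
    also have "\<dots> \<le> Q powr 0" using Q by (intro powr_mono) auto
    finally have "real (q (Suc n)) * grid_radius \<phi> (q (Suc n)) \<le> 1"
      using Q by (simp add: Q_def grid_radius_def)
    then obtain B where B: "finite B" "E \<subseteq> (\<Union>g\<in>B. cball g (r (Suc n)))"
        "real (card B) \<le> real (card A) * (3 * (1 + real (q (Suc n)) * r n))"
      using cover_refine[OF A(1,2) E_sub[of "Suc n"] _ r_ge] q_ge[of "Suc n"] by (auto simp: r_def)
    note B(3)
    also have "real (card A) * (3 * (1 + real (q (Suc n)) * r n))
        \<le> (K * 3 ^ n * P n) * (3 * (1 + real (q (Suc n)) * r n))"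
      using A(3) r_ge by (intro mult_right_mono) auto
    also have "\<dots> = K * 3 ^ Suc n * P (Suc n)" using P_Suc[OF n] by simp
    finally show ?case using B by blast
  qed
  obtain A where A: "\<And>n. n \<ge> N \<Longrightarrow> finite (A n) \<and> E \<subseteq> (\<Union>g\<in>A n. cball g (r n)) \<and>
      real (card (A n)) \<le> K * 3 ^ n * P n"
    using cover by metis
  have A_ev: "\<forall>\<^sub>F n in sequentially. finite (A n) \<and> E \<subseteq> (\<Union>g\<in>A n. cball g (r n))"
    using eventually_ge_at_top[of N] by eventually_elim (use A in blast)

  \<comment> \<open>Vanishing measure for \<open>s > 1 - \<epsilon>\<close>, and the dimension
    bound\<close>
  have measure_0: "hausdorff_measure (log_gauge s) E = 0" if s: "s > 0" "s > 1 - \<epsilon>" for s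
  proof (rule hausdorff_measure_eq_0I[OF gauge_function_log_gauge[OF s(1)] A_ev r_ge r_lim])
    define d where "d = s - (1 - \<epsilon>)"
    have "d > 0" using s by (simp add: d_def)
    define D where "D = K * C * 2 powr s"
    have "D \<ge> 0" using C_pos by (simp add: D_def K_def)
    have "(\<lambda>n. D * (3 ^ n * L n powr (- d))) \<longlonglongrightarrow> 0"
      using tendsto_mult_right_zero[OF L_lim[of 3 d]] \<open>d > 0\<close> by simp
    moreover have "\<forall>\<^sub>F n in sequentially. real (card (A n)) * log_gauge s (2 * r n)
        \<le> D * (3 ^ n * L n powr (- d))"
    proof -
      have "\<forall>\<^sub>F n in sequentially. x n \<ge> 2" using x_top by (simp add: filterlim_at_top)
      with eventually_ge_at_top[of N] r_eq x_ge L_ev growth' show ?thesis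
      proof eventually_elim
        case (elim n)
        have "real (card (A n)) \<le> K * 3 ^ n * P n" using A elim by blast
        also have "\<dots> \<le> K * 3 ^ n * (C * x n powr (1 - \<epsilon>))"
          using elim by (intro mult_left_mono) (auto simp: K_def)
        finally have "real (card (A n)) \<le> K * 3 ^ n * (C * x n powr (1 - \<epsilon>))" .
        moreover have "log_gauge s (2 * r n) \<le> 2 powr s * x n powr (- s)"
          using log_gauge_le[of s "x n"] s elim by simp
        moreover have "log_gauge s (2 * r n) \<ge> 0" by (simp add: log_gauge_def)
        ultimately have "real (card (A n)) * log_gauge s (2 * r n)
            \<le> (K * 3 ^ n * (C * x n powr (1 - \<epsilon>))) * (2 powr s * x n powr (- s))"
          using C_pos by (intro mult_mono) (auto simp: K_def)
        also have "\<dots> = D * (3 ^ n * x n powr (- d))"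
          using powr_add[of "x n" "1 - \<epsilon>" "- s"] by (simp add: D_def d_def)
        \<comment> \<open>Passing from \<open>x n\<close> down to \<open>L n\<close> enlarges the
          negative power, and only \<open>L\<close> has a recursion strong enough to beat
          \<open>3 ^ n\<close>.\<close>
        also have "\<dots> \<le> D * (3 ^ n * L n powr (- d))"
          using \<open>D \<ge> 0\<close> \<open>d > 0\<close> elim by (intro mult_left_mono powr_mono2') auto
        finally show ?case .
      qed
    qed
    moreover have "\<forall>\<^sub>F n in sequentially. 0 \<le> real (card (A n)) * log_gauge s (2 * r n)"
      by (simp add: log_gauge_def)
    ultimately show "(\<lambda>n. real (card (A n)) * log_gauge s (2 * r n)) \<longlonglongrightarrow> 0"
      by - (rule tendsto_sandwich[OF _ _ tendsto_const])
  qed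

  text \<open>The products are at least \<open>1\<close>, so the growth hypothesis cannot hold with \<open>\<epsilon> > 1\<close>.\<close>
  have \<epsilon>_le: "\<epsilon> \<le> 1"
  proof (rule ccontr)
    assume "\<not> \<epsilon> \<le> 1"
    then have "(\<lambda>n. x n powr (- (\<epsilon> - 1))) \<longlonglongrightarrow> 0"
      using x_top by (intro tendsto_neg_powr) auto
    from tendsto_mult_right_zero[OF this, of C] have "(\<lambda>n. C * x n powr (1 - \<epsilon>)) \<longlonglongrightarrow> 0"
      by simp
    moreover have "\<forall>\<^sub>F n in sequentially. 1 \<le> C * x n powr (1 - \<epsilon>)"
      using growth' by eventually_elim (use P_ge order_trans in blast)
    ultimately have "(1::real) \<le> 0" by (rule tendsto_lowerbound) simp
    then show False by simp
  qed
  have le: "log_hausdorff_dim E \<le> ereal (1 - \<epsilon>)"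
  proof (rule ereal_le_epsilon2)
    fix e :: real assume "e > 0"
    \<comment> \<open>The infimum ranges over positive exponents only;
      \<open>\<epsilon> \<le> 1\<close> makes \<open>1 - \<epsilon> + e\<close> one of them.\<close>
    then have "hausdorff_measure (log_gauge (1 - \<epsilon> + e)) E = 0" "1 - \<epsilon> + e > 0"
      using \<epsilon>_le measure_0[of "1 - \<epsilon> + e"] by auto
    then show "log_hausdorff_dim E \<le> ereal (1 - \<epsilon>) + ereal e"
      unfolding log_hausdorff_dim_def by (intro Inf_lower) auto
  qed
  moreover have "ereal (1 - \<epsilon>) < 1" using \<epsilon>_pos by (simp flip: one_ereal_def)
  ultimately show ?thesis by (metis le_less_trans)
qed

end
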